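(* Let $\{R_i\}_{i=0}^\infty$ and $\{T_i\}_{i=0}^\infty$ be increasing sequences of commutative rings with identity (that is, $R_i$ is a subring of $R_{i+1}$ and $T_i$ is a subring of $T_{i+1}$ for every $i\ge 0$) such that $R_i$ is a subring of $T_i$ for each $i\geq 0$, all these rings sharing the same identity element. Let $J_i=\bigcap_{k=0}^\infty (R_{i+k}:T_k)$ for each $i\geq 0$, and $J=\bigcup_{i=0}^\infty J_i$. Also assume that for each $i\geq 1$, $\mathrm{Nil}(T_i)\subseteq R_i$ (in particular, this holds when each $T_i$ is reduced). Then $R_{\mathbb{N}_0}[x]$ is a locally associated subring of $T_{\mathbb{N}_0}[x]$ if and only if the following conditions both hold: (1) for every element $t_0\in T_0$ comaximal to $J_0$ (i.e., $t_0T_0+J_0=T_0$), there exists a unit $u\in U(T_0)$ such that $t_0u$ is an element of $R_0$ comaximal to $J_0$ (i.e., $t_0u\in R_0$ and $t_0uR_0+J_0=R_0$); (2) for every $k\geq 1$, $\sqrt{T_k\cap J}\subseteq R_k$, where $\sqrt{T_k\cap J}=\{t\in T_k : t^n\in J\text{ for some } n\ge 1\}$.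
   Context: $U(A)$ denotes the group of units of a commutative ring $A$ with identity, and $\mathrm{Nil}(A)$ the set of nilpotent elements of $A$. For subrings $A$ and $B$ of the same commutative ring (with $A$ not necessarily contained in $B$), the conductor is $(A:B)=\{a\in A : aB\subseteq A\}$. For an increasing sequence of commutative rings $\{A_i\}_{i=0}^\infty$ with union $A$, $A_{\mathbb{N}_0}[x]$ denotes the subring of $A[x]$ consisting of all polynomials whose coefficient of $x^i$ lies in $A_i$ for every $i\ge 0$. A subring $R$ (containing the identity) of a commutative ring $T$ with identity, with $I=(R:T)$, is a locally associated subring of $T$ if for every $t\in T$ with $tT+I=T$ there exist $r\in R$ with $rR+I=R$ and $u\in U(T)$ such that $t=ru$. *)

theory Defs
  imports "HOL-Algebra.UnivPoly" "HOL-Algebra.Subrings"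
begin

text \<open>All rings under consideration are subrings, given by their underlying sets, of an ambient
  commutative ring. The trivial ring is allowed.\<close>

definition nilpotents :: "('a, 'm) ring_scheme \<Rightarrow> 'a set \<Rightarrow> 'a set" where
  "nilpotents G A = {a \<in> A. \<exists>n::nat. n \<ge> 1 \<and> a [^]\<^bsub>G\<^esub> n = \<zero>\<^bsub>G\<^esub>}"

text \<open>The conductor \<open>(A : B)\<close>; \<open>A\<close> need not be contained in \<open>B\<close>.\<close>

definition conductor :: "('a, 'm) ring_scheme \<Rightarrow> 'a set \<Rightarrow> 'a set \<Rightarrow> 'a set" where
  "conductor G A B = {a \<in> A. a <#\<^bsub>G\<^esub> B \<subseteq> A}"

definition comaximal_in :: "('a, 'm) ring_scheme \<Rightarrow> 'a set \<Rightarrow> 'a \<Rightarrow> 'a set \<Rightarrow> bool" where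
  "comaximal_in G A a I \<longleftrightarrow> (a <#\<^bsub>G\<^esub> A) <+>\<^bsub>G\<^esub> I = A"

definition locally_associated_subring :: "'a set \<Rightarrow> ('a, 'm) ring_scheme \<Rightarrow> bool" where
  "locally_associated_subring R T \<longleftrightarrow>
     cring T \<and> subring R T \<and>
     (\<forall>t \<in> carrier T. comaximal_in T (carrier T) t (conductor T R (carrier T)) \<longrightarrow>
        (\<exists>r \<in> R. comaximal_in T R r (conductor T R (carrier T)) \<and>
           (\<exists>u \<in> Units T. t = r \<otimes>\<^bsub>T\<^esub> u)))"

text \<open>The polynomials over the ambient ring \<open>G\<close> whose \<open>i\<close>-th coefficient lies in \<open>A i\<close> for all
  \<open>i\<close>. Since every coefficient then lies in the union of the \<open>A i\<close>, the choice of the ambient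
  ring does not matter.\<close>

definition seq_polys :: "('a, 'm) ring_scheme \<Rightarrow> (nat \<Rightarrow> 'a set) \<Rightarrow> (nat \<Rightarrow> 'a) set" where
  "seq_polys G A = {p \<in> carrier (UP G). \<forall>i. coeff (UP G) p i \<in> A i}"

definition conductor_seq ::
    "('a, 'm) ring_scheme \<Rightarrow> (nat \<Rightarrow> 'a set) \<Rightarrow> (nat \<Rightarrow> 'a set) \<Rightarrow> nat \<Rightarrow> 'a set" where
  "conductor_seq G R T i = (\<Inter>k. conductor G (R (i + k)) (T k))"

end

theory Submission imports Defs begin

text \<open>
  Write \<open>R\<^sub>N\<close> and \<open>T\<^sub>N\<close> for the two rings of polynomials with graded coefficient conditions.
  Testing against the monomials \<open>t x^k\<close> with \<open>t \<in> T\<^sub>k\<close> shows that the conductor of \<open>R\<^sub>N\<close> in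
  \<open>T\<^sub>N\<close> consists of the polynomials whose \<open>i\<close>-th coefficient lies in \<open>J\<^sub>i\<close>
  (\<open>conductor_seq_polys\<close>). The \<open>J\<^sub>i\<close> satisfy \<open>J\<^sub>i T\<^sub>k \<subseteq> J\<^bsub>i+k\<^esub>\<close>, so their union \<open>J\<close> is an ideal
  of the union of the \<open>T\<^sub>i\<close>. The second ingredient is that a polynomial which is a unit modulo an
  ideal \<open>I\<close> has all coefficients except the constant one in the radical of \<open>I\<close>
  (\<open>coeff_radical_of_unit_mod_ideal\<close>). With \<open>I = J\<close> it describes the polynomials comaximal to the
  conductor, with \<open>I = 0\<close> the units of \<open>T\<^sub>N\<close>.

  Suppose that \<open>R\<^sub>N\<close> is locally associated. The first condition comes from factoring the constant
  polynomial \<open>t\<^sub>0\<close> and comparing constant coefficients. For the second, let \<open>t \<in> T\<^sub>k\<close> have a power in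
  \<open>J\<close>. Because \<open>k \<ge> 1\<close>, a high power of \<open>t x^k\<close> lies in the conductor, so the geometric sum
  makes \<open>1 - t x^k\<close> comaximal to it, and \<open>1 - t x^k = r u\<close> with \<open>r\<close> in \<open>R\<^sub>N\<close> and \<open>u\<close> a unit of
  \<open>T\<^sub>N\<close>. The higher coefficients of \<open>u\<close> are nilpotent, hence in the \<open>R\<^sub>i\<close>, and comaximality of
  \<open>r\<close> puts the constant coefficient of \<open>u\<close> into \<open>R\<^sub>0\<close>. So \<open>u\<close>, and with it \<open>1 - t x^k\<close>, is in
  \<open>R\<^sub>N\<close>.

  Conversely let \<open>f g + h = 1\<close> with \<open>h\<close> in the conductor. The first condition gives a unit \<open>u\<close> of
  \<open>T\<^sub>0\<close> that moves the constant coefficient of \<open>f\<close> into \<open>R\<^sub>0\<close> and makes it comaximal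
  to \<open>J\<^sub>0\<close> there, which forces the constant coefficient of \<open>u\<^sup>-\<^sup>1 g\<close> into \<open>R\<^sub>0\<close> as well. The
  higher coefficients of \<open>f u\<close> and of \<open>u\<^sup>-\<^sup>1 g\<close> have powers in \<open>J\<close>, so the second condition
  applies to them. Hence both polynomials lie in \<open>R\<^sub>N\<close>, and \<open>(f u) (u\<^sup>-\<^sup>1 g) + h = 1\<close> witnesses comaximality there.
\<close>

section \<open>Comaximality and radicals in a commutative ring\<close>

context cring
begin

lemma finsum_in_additive_subgroup:
  assumes "additive_subgroup N R" and "finite K" and "\<And>i. i \<in> K \<Longrightarrow> f i \<in> N"
  shows "finsum R f K \<in> N"
proof -
  interpret N: additive_subgroup N R by fact
  show ?thesis
    using assms(2,3)
  proof (induction K rule: finite_induct)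
    case (insert x F)
    then have "f \<in> F \<rightarrow> carrier R" "f x \<in> carrier R" by auto
    with insert show ?case by simp
  qed simp
qed

lemma additive_subgroup_cancel_right:
  assumes "additive_subgroup N R" and "x \<in> carrier R" "y \<in> N" "x \<oplus> y \<in> N"
  shows "x \<in> N"
proof -
  interpret N: additive_subgroup N R by fact
  have y: "y \<in> carrier R" using assms(3) by simp
  have "x = (x \<oplus> y) \<oplus> (\<ominus> y)" using assms(2) y by algebra
  also have "\<dots> \<in> N" by (rule N.a_closed[OF assms(4) N.a_inv_closed[OF assms(3)]])
  finally show ?thesis .
qed

text \<open>The subset \<open>a B + I\<close> is all of \<open>B\<close> as soon as it contains \<open>1\<close>: multiply the expression for
  \<open>1\<close> by an arbitrary element of \<open>B\<close>.\<close>

lemma comaximal_in_iff: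
  assumes "subring B R" and "additive_subgroup I R" and "I \<subseteq> B"
    and absorb: "\<And>i b. i \<in> I \<Longrightarrow> b \<in> B \<Longrightarrow> i \<otimes> b \<in> I" and "a \<in> B"
  shows "comaximal_in R B a I \<longleftrightarrow> (\<exists>b\<in>B. \<exists>i\<in>I. a \<otimes> b \<oplus> i = \<one>)"
proof -
  note B = subringE[OF assms(1)]
  have eq: "set_add R (a <# B) I = {a \<otimes> b \<oplus> i | b i. b \<in> B \<and> i \<in> I}"
    by (auto simp: l_coset_def set_add_def set_mult_def)
  show ?thesis
  proof
    assume "comaximal_in R B a I"
    then have "\<one> \<in> set_add R (a <# B) I"
      using B(3) by (simp add: comaximal_in_def)
    then show "\<exists>b\<in>B. \<exists>i\<in>I. a \<otimes> b \<oplus> i = \<one>" unfolding eq by force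
  next
    assume "\<exists>b\<in>B. \<exists>i\<in>I. a \<otimes> b \<oplus> i = \<one>"
    then obtain b i where bi: "b \<in> B" "i \<in> I" "a \<otimes> b \<oplus> i = \<one>" by blast
    have "set_add R (a <# B) I \<subseteq> B"
      unfolding eq using B(6,7) assms(3,5) by auto
    moreover have "c \<in> set_add R (a <# B) I" if c: "c \<in> B" for c
    proof -
      have carr: "a \<in> carrier R" "b \<in> carrier R" "c \<in> carrier R" "i \<in> carrier R"
        using bi(1,2) c B(1) assms(3,5) by auto
      have "c = (a \<otimes> b \<oplus> i) \<otimes> c" using carr bi(3) by simp
      also have "\<dots> = a \<otimes> (b \<otimes> c) \<oplus> i \<otimes> c" using carr by algebra
      finally show ?thesis
        unfolding eq using B(6)[OF bi(1) c] absorb[OF bi(2) c] by blast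
    qed
    ultimately show "comaximal_in R B a I" by (auto simp: comaximal_in_def)
  qed
qed

definition radical_ideal :: "'a set \<Rightarrow> 'a set" where
  "radical_ideal I = {a \<in> carrier R. \<exists>n::nat. n \<ge> 1 \<and> a [^] n \<in> I}"

text \<open>This shows that a radical is closed under addition without the binomial theorem. The factor \<open>c\<close>
  makes the induction on \<open>n + m\<close> work: splitting off one factor \<open>a + b\<close> replaces \<open>c\<close> by \<open>c a\<close>
  and \<open>c b\<close>, which lowers one of the exponents.\<close>

lemma pow_add_in_ideal:
  assumes "ideal I R" and "a \<in> carrier R" "b \<in> carrier R" "c \<in> carrier R"
    and "c \<otimes> a [^] (n::nat) \<in> I" "c \<otimes> b [^] (m::nat) \<in> I"
  shows "c \<otimes> (a \<oplus> b) [^] (n + m) \<in> I"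
  using assms(4-6)
proof (induction "n + m" arbitrary: n m c)
  case 0
  then show ?case by simp
next
  case (Suc l)
  interpret I: ideal I R by fact
  note ab = assms(2,3)
  show ?case
  proof (cases "n = 0 \<or> m = 0")
    case True
    then have "c \<in> I" using Suc.prems by auto
    then show ?thesis using ab by (simp add: I.I_r_closed)
  next
    case False
    then obtain n' m' where nm: "n = Suc n'" "m = Suc m'"
      by (meson not0_implies_Suc)
    have l: "l = n' + m" "l = n + m'" using Suc.hyps(2) nm by auto
    have "(c \<otimes> a) \<otimes> (a \<oplus> b) [^] (n' + m) \<in> I"
    proof (rule Suc.hyps(1)[OF l(1)])
      have "(c \<otimes> a) \<otimes> a [^] n' = c \<otimes> a [^] n"
        using nm ab Suc.prems(1) by (simp add: m_ac)
      then show "(c \<otimes> a) \<otimes> a [^] n' \<in> I" using Suc.prems by simp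
      have "(c \<otimes> a) \<otimes> b [^] m = a \<otimes> (c \<otimes> b [^] m)"
        using ab Suc.prems(1) by (simp add: m_ac)
      then show "(c \<otimes> a) \<otimes> b [^] m \<in> I"
        using ab Suc.prems by (simp add: I.I_l_closed)
    qed (use ab Suc.prems in simp)
    moreover have "(c \<otimes> b) \<otimes> (a \<oplus> b) [^] (n + m') \<in> I"
    proof (rule Suc.hyps(1)[OF l(2)])
      have "(c \<otimes> b) \<otimes> b [^] m' = c \<otimes> b [^] m"
        using nm ab Suc.prems(1) by (simp add: m_ac)
      then show "(c \<otimes> b) \<otimes> b [^] m' \<in> I" using Suc.prems by simp
      have "(c \<otimes> b) \<otimes> a [^] n = b \<otimes> (c \<otimes> a [^] n)"
        using ab Suc.prems(1) by (simp add: m_ac)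
      then show "(c \<otimes> b) \<otimes> a [^] n \<in> I"
        using ab Suc.prems by (simp add: I.I_l_closed)
    qed (use ab Suc.prems in simp)
    ultimately have "(c \<otimes> a) \<otimes> (a \<oplus> b) [^] l \<oplus> (c \<otimes> b) \<otimes> (a \<oplus> b) [^] l \<in> I"
      using l by simp
    moreover have "c \<otimes> (a \<oplus> b) [^] (n + m)
        = (c \<otimes> a) \<otimes> (a \<oplus> b) [^] l \<oplus> (c \<otimes> b) \<otimes> (a \<oplus> b) [^] l"
    proof -
      have x: "(a \<oplus> b) [^] l \<in> carrier R" using ab by simp
      have "c \<otimes> (x \<otimes> (a \<oplus> b)) = (c \<otimes> a) \<otimes> x \<oplus> (c \<otimes> b) \<otimes> x"
        if "x \<in> carrier R" for x
        using that ab Suc.prems(1) by algebra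
      from this[OF x] show ?thesis by (simp flip: Suc.hyps(2))
    qed
    ultimately show ?thesis by simp
  qed
qed

lemma ideal_radical_ideal:
  assumes "ideal I R"
  shows "ideal (radical_ideal I) R"
proof -
  interpret I: ideal I R by fact
  have mult: "x \<otimes> a \<in> radical_ideal I" if "a \<in> radical_ideal I" "x \<in> carrier R" for a x
  proof -
    from that obtain n :: nat where n: "n \<ge> 1" "a [^] n \<in> I" "a \<in> carrier R"
      by (auto simp: radical_ideal_def)
    then have "(x \<otimes> a) [^] n \<in> I"
      using that(2) by (simp add: nat_pow_distrib I.I_l_closed)
    then show ?thesis using n that(2) by (auto simp: radical_ideal_def)
  qed
  show ?thesis
  proof (rule idealI[OF ring_axioms])
    show "subgroup (radical_ideal I) (add_monoid R)"
    proof (rule add.subgroupI)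
      show "radical_ideal I \<subseteq> carrier R" by (auto simp: radical_ideal_def)
      have "\<zero> \<in> radical_ideal I"
        by (auto simp: radical_ideal_def intro!: exI[of _ "1::nat"])
      then show "radical_ideal I \<noteq> {}" by auto
    next
      fix a assume a: "a \<in> radical_ideal I"
      then have "a \<in> carrier R" by (auto simp: radical_ideal_def)
      then have "\<ominus> a = (\<ominus> \<one>) \<otimes> a" by (simp add: l_minus)
      then show "\<ominus> a \<in> radical_ideal I" using mult[OF a] by simp
    next
      fix a b assume "a \<in> radical_ideal I" "b \<in> radical_ideal I"
      then obtain n m :: nat where nm: "n \<ge> 1" "m \<ge> 1" "a [^] n \<in> I" "b [^] m \<in> I"
        and ab: "a \<in> carrier R" "b \<in> carrier R"
        by (auto simp: radical_ideal_def)
      then have "\<one> \<otimes> (a \<oplus> b) [^] (n + m) \<in> I"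
        by (intro pow_add_in_ideal[OF assms]) auto
      then show "a \<oplus> b \<in> radical_ideal I"
        using ab nm by (auto simp: radical_ideal_def intro!: exI[of _ "n + m"])
    qed
  next
    fix a x assume ax: "a \<in> radical_ideal I" "x \<in> carrier R"
    then show "x \<otimes> a \<in> radical_ideal I" by (rule mult)
    have "a \<otimes> x = x \<otimes> a" using ax by (auto simp: radical_ideal_def m_comm)
    then show "a \<otimes> x \<in> radical_ideal I" using mult[OF ax] by simp
  qed
qed

lemma radical_ideal_square:
  assumes "a \<in> carrier R" and "a \<otimes> a \<in> radical_ideal I"
  shows "a \<in> radical_ideal I"
proof -
  obtain n :: nat where n: "n \<ge> 1" "(a \<otimes> a) [^] n \<in> I"
    using assms(2) by (auto simp: radical_ideal_def)
  then have "a [^] (n + n) \<in> I"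
    using assms(1) by (simp add: nat_pow_distrib flip: nat_pow_mult)
  with n assms(1) show ?thesis by (auto simp: radical_ideal_def intro!: exI[of _ "n + n"])
qed

text \<open>Modulo an ideal \<open>N\<close> equal to its radical, \<open>f\<close> and \<open>g\<close> are inverse polynomials over a reduced
  ring, and the leading coefficient \<open>a\<close> of \<open>f\<close>, of index \<open>Suc n\<close>, annihilates every coefficient
  of \<open>g\<close> modulo \<open>N\<close>. This follows by descent on the index \<open>j\<close>: multiplied by \<open>a\<close>, the coefficient of \<open>f g\<close>
  at \<open>Suc n + j\<close> has all its terms but \<open>a a g\<^sub>j\<close> in \<open>N\<close>, so \<open>(a g\<^sub>j)\<^sup>2\<close> is in \<open>N\<close>. Since \<open>g\<^sub>0\<close>
  is a unit modulo \<open>N\<close>, it follows that \<open>a\<close> is in \<open>N\<close>, and the degree of \<open>f\<close> modulo \<open>N\<close> drops.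
  Sequences take the place of polynomials because the coefficients live in a subring other than
  the one over which the polynomial ring is formed.\<close>

lemma convolution_unit_mod_radical:
  fixes f g :: "nat \<Rightarrow> 'a"
  assumes "ideal N R" and rad: "\<And>a. a \<in> carrier R \<Longrightarrow> a \<otimes> a \<in> N \<Longrightarrow> a \<in> N"
    and f: "\<And>i. f i \<in> carrier R" and g: "\<And>i. g i \<in> carrier R"
    and fN: "\<And>i. i > n \<Longrightarrow> f i \<in> N" and gN: "\<And>i. i > m \<Longrightarrow> g i \<in> N"
    and conv: "\<And>k. k \<ge> 1 \<Longrightarrow> (\<Oplus>i\<in>{..k}. f i \<otimes> g (k - i)) \<in> N"
    and h: "h \<in> N" and unit: "f 0 \<otimes> g 0 \<oplus> h = \<one>"
    and "i \<ge> 1"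
  shows "f i \<in> N"
  using fN
proof (induction n)
  case 0
  then show ?case using \<open>i \<ge> 1\<close> by simp
next
  case (Suc n)
  interpret N: ideal N R by fact
  have sub: "additive_subgroup N R" ..
  note beyond = Suc.prems
  let ?a = "f (Suc n)"
  have descend: "\<forall>j. m < j + d \<longrightarrow> ?a \<otimes> g j \<in> N" for d
  proof (induction d)
    case 0
    then show ?case using gN f by (auto intro: N.I_l_closed)
  next
    case (Suc d)
    show ?case
    proof (intro allI impI)
      fix j assume j: "m < j + Suc d"
      let ?k = "Suc n + j"
      let ?t = "\<lambda>i. ?a \<otimes> (f i \<otimes> g (?k - i))"
      have "?a \<otimes> (\<Oplus>i\<in>{..?k}. f i \<otimes> g (?k - i)) \<in> N"
        using conv[of ?k] f by (intro N.I_l_closed) auto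
      also have "?a \<otimes> (\<Oplus>i\<in>{..?k}. f i \<otimes> g (?k - i)) = (\<Oplus>i\<in>{..?k}. ?t i)"
        using f g by (intro finsum_rdistr) auto
      also have "\<dots> = (\<Oplus>i\<in>insert (Suc n) ({..?k} - {Suc n}). ?t i)"
        by (rule arg_cong[where f = "finsum R ?t"]) auto
      also have "\<dots> = ?t (Suc n) \<oplus> (\<Oplus>i\<in>{..?k} - {Suc n}. ?t i)"
        using f g by (intro finsum_insert) auto
      finally have total: "?t (Suc n) \<oplus> (\<Oplus>i\<in>{..?k} - {Suc n}. ?t i) \<in> N" .
      have rest: "(\<Oplus>i\<in>{..?k} - {Suc n}. ?t i) \<in> N"
      proof (rule finsum_in_additive_subgroup[OF sub])
        fix i assume i: "i \<in> {..?k} - {Suc n}"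
        show "?t i \<in> N"
        proof (cases "i > Suc n")
          case True
          then show ?thesis
            using beyond[OF True] f g by (intro N.I_l_closed[OF N.I_r_closed]) auto
        next
          case False
          with i have "m < (?k - i) + d" using j by auto
          then have "?a \<otimes> g (?k - i) \<in> N" using Suc.IH by blast
          then have "f i \<otimes> (?a \<otimes> g (?k - i)) \<in> N" using f by (auto intro: N.I_l_closed)
          moreover have "?t i = f i \<otimes> (?a \<otimes> g (?k - i))" using f g by (simp add: m_ac)
          ultimately show ?thesis by simp
        qed
      qed simp
      have "?t (Suc n) \<in> N"
        by (rule additive_subgroup_cancel_right[OF sub _ rest total]) (use f g in auto)
      then have "?t (Suc n) \<otimes> g j \<in> N" using g by (auto intro: N.I_r_closed)
      moreover have "?t (Suc n) \<otimes> g j = (?a \<otimes> g j) \<otimes> (?a \<otimes> g j)"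
        using f g by (simp add: m_ac)
      ultimately show "?a \<otimes> g j \<in> N" using rad[of "?a \<otimes> g j"] f g by simp
    qed
  qed
  have "?a \<otimes> g 0 \<in> N" using descend[of "Suc m"] by simp
  then have "f 0 \<otimes> (?a \<otimes> g 0) \<oplus> ?a \<otimes> h \<in> N"
    using f h by (auto intro!: N.I_l_closed N.a_closed)
  moreover have "f 0 \<otimes> (?a \<otimes> g 0) \<oplus> ?a \<otimes> h = ?a"
  proof -
    have hc: "h \<in> carrier R" using h by simp
    have "f 0 \<otimes> (?a \<otimes> g 0) \<oplus> ?a \<otimes> h = ?a \<otimes> (f 0 \<otimes> g 0 \<oplus> h)"
      using f[of 0] f[of "Suc n"] g[of 0] hc by algebra
    then show ?thesis using unit f by simp
  qed
  ultimately have "?a \<in> N" by simp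
  then have "f i \<in> N" if "i > n" for i
    using beyond[of i] that by (cases "i = Suc n") auto
  then show ?case by (rule Suc.IH)
qed

lemma geometric_sum_in_subring:
  assumes "subring S R" and "z \<in> S"
  shows "\<exists>s\<in>S. (\<one> \<ominus> z) \<otimes> s \<oplus> z [^] (n::nat) = \<one>"
proof (induction n)
  note S = subringE[OF assms(1)]
  case 0
  then show ?case using S assms(2) by (intro bexI[of _ \<zero>]) auto
next
  note S = subringE[OF assms(1)]
  case (Suc n)
  then obtain s where s: "s \<in> S" "(\<one> \<ominus> z) \<otimes> s \<oplus> z [^] n = \<one>" by blast
  have carr: "s \<in> carrier R" "z \<in> carrier R" "z [^] n \<in> carrier R"
    using S(1) s(1) assms(2) by auto
  have zn: "z [^] k \<in> S" for k :: nat
    by (induction k) (use S assms(2) in auto)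
  have "(\<one> \<ominus> z) \<otimes> (s \<oplus> x) \<oplus> x \<otimes> z = (\<one> \<ominus> z) \<otimes> s \<oplus> x" if "x \<in> carrier R" for x
    using that carr by algebra
  from this[OF carr(3)] have "(\<one> \<ominus> z) \<otimes> (s \<oplus> z [^] n) \<oplus> z [^] Suc n = \<one>"
    using s(2) by simp
  then show ?case using S(7)[OF s(1) zn] by blast
qed

end


section \<open>Polynomials with graded coefficient conditions\<close>

context UP_cring
begin

lemma coeff_mult_0:
  assumes "p \<in> carrier P" "q \<in> carrier P"
  shows "coeff P (p \<otimes>\<^bsub>P\<^esub> q) 0 = coeff P p 0 \<otimes> coeff P q 0"
  using assms by simp

lemma monom_pow:
  assumes "a \<in> carrier R"
  shows "monom P a k [^]\<^bsub>P\<^esub> (n::nat) = monom P (a [^] n) (k * n)"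
proof (induction n)
  case (Suc n)
  have "monom P (a [^] n \<otimes> a) (k * n + k) = monom P (a [^] n) (k * n) \<otimes>\<^bsub>P\<^esub> monom P a k"
    using assms by (intro monom_mult) auto
  then show ?case using Suc by (simp add: add.commute)
qed (use assms in simp)

lemma coeff_eventually_zero:
  assumes "p \<in> carrier P" obtains n where "\<And>i. i > n \<Longrightarrow> coeff P p i = \<zero>"
  using assms deg_aboveD by blast

text \<open>The ideal is one of a subring \<open>S\<close> containing the coefficients, since the ideal to be used below need
  not be closed under multiplication by the whole ambient ring.\<close>

lemma coeff_radical_of_unit_mod_ideal:
  assumes S: "subring S R" and I: "ideal I (R\<lparr>carrier := S\<rparr>)"
    and f: "f \<in> carrier P" "\<And>i. coeff P f i \<in> S"
    and g: "g \<in> carrier P" "\<And>i. coeff P g i \<in> S"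
    and h: "h \<in> carrier P" "\<And>i. coeff P h i \<in> I"
    and fgh: "f \<otimes>\<^bsub>P\<^esub> g \<oplus>\<^bsub>P\<^esub> h = \<one>\<^bsub>P\<^esub>" and "i \<ge> 1"
  shows "\<exists>n::nat. n \<ge> 1 \<and> coeff P f i [^] n \<in> I"
proof -
  let ?S = "R\<lparr>carrier := S\<rparr>"
  interpret S: cring ?S
    using R.subcring_iff[OF subringE(1)[OF S]] R.subcringI'[OF S] by simp
  interpret I: ideal I ?S by fact
  \<comment> \<open>The inclusion of \<open>S\<close> is a homomorphism, so finite sums agree in \<open>S\<close> and in the ambient ring.\<close>
  interpret inc: ring_hom_cring ?S R "\<lambda>x. x"
    using subringE(1)[OF S]
    by unfold_locales (auto simp: ring_hom_def)
  define N where "N = S.radical_ideal I"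
  interpret N: ideal N ?S unfolding N_def by (rule S.ideal_radical_ideal[OF I])
  have IN: "a \<in> N" if "a \<in> I" for a
    using that I.Icarr[OF that] unfolding N_def S.radical_ideal_def
    by (auto intro!: exI[of _ "1::nat"])
  obtain n where n: "\<And>i. i > n \<Longrightarrow> coeff P f i = \<zero>"
    using coeff_eventually_zero[OF f(1)] by blast
  obtain m where m: "\<And>i. i > m \<Longrightarrow> coeff P g i = \<zero>"
    using coeff_eventually_zero[OF g(1)] by blast
  have zN: "\<zero> \<in> N" using N.zero_closed by simp
  have sumk: "(\<Oplus>i\<in>{..k}. coeff P f i \<otimes> coeff P g (k - i)) \<oplus> coeff P h k
      = (if k = 0 then \<one> else \<zero>)" for k
  proof -
    have "coeff P (f \<otimes>\<^bsub>P\<^esub> g \<oplus>\<^bsub>P\<^esub> h) k = coeff P \<one>\<^bsub>P\<^esub> k" using fgh by simp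
    then show ?thesis using f g h by simp
  qed
  have tr: "(\<Oplus>\<^bsub>?S\<^esub>i\<in>{..k}. coeff P f i \<otimes> coeff P g (k - i))
      = (\<Oplus>i\<in>{..k}. coeff P f i \<otimes> coeff P g (k - i))" for k
    using inc.hom_finsum[of "\<lambda>i. coeff P f i \<otimes> coeff P g (k - i)" "{..k}"] f(2) g(2)
      subringE(6)[OF S]
    by (auto simp: Pi_def comp_def)
  have "coeff P f i \<in> N"
  proof (rule S.convolution_unit_mod_radical[where f = "coeff P f" and g = "coeff P g"
        and N = N and n = n and m = m and h = "coeff P h 0"])
    show "ideal N ?S" ..
    show "a \<in> N" if "a \<in> carrier ?S" "a \<otimes>\<^bsub>?S\<^esub> a \<in> N" for a
      using S.radical_ideal_square[of a I] that by (simp add: N_def)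
    show "(\<Oplus>\<^bsub>?S\<^esub>i\<in>{..k}. coeff P f i \<otimes>\<^bsub>?S\<^esub> coeff P g (k - i)) \<in> N" if "k \<ge> 1" for k
    proof (rule S.additive_subgroup_cancel_right)
      show "additive_subgroup N ?S" ..
      show "coeff P h k \<in> N" using IN h by auto
      show "(\<Oplus>\<^bsub>?S\<^esub>i\<in>{..k}. coeff P f i \<otimes>\<^bsub>?S\<^esub> coeff P g (k - i)) \<in> carrier ?S"
        using f(2) g(2) subringE(6)[OF S] by (intro S.finsum_closed) auto
      show "(\<Oplus>\<^bsub>?S\<^esub>i\<in>{..k}. coeff P f i \<otimes>\<^bsub>?S\<^esub> coeff P g (k - i)) \<oplus>\<^bsub>?S\<^esub> coeff P h k \<in> N"
        using sumk[of k] that zN by (simp add: tr)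
    qed
    show "coeff P f 0 \<otimes>\<^bsub>?S\<^esub> coeff P g 0 \<oplus>\<^bsub>?S\<^esub> coeff P h 0 = \<one>\<^bsub>?S\<^esub>"
      using sumk[of 0] f(1) g(1) by simp
  qed (use f g h n m zN IN \<open>i \<ge> 1\<close> in auto)
  then show ?thesis
    unfolding N_def S.radical_ideal_def using R.nat_pow_consistent by auto
qed

lemma seq_polysD:
  assumes "p \<in> seq_polys R B"
  shows "p \<in> carrier P" "coeff P p i \<in> B i"
  using assms by (auto simp: seq_polys_def P_def)

lemma seq_polysI:
  assumes "p \<in> carrier P" "\<And>i. coeff P p i \<in> B i"
  shows "p \<in> seq_polys R B"
  using assms by (auto simp: seq_polys_def P_def)

lemma seq_polys_mult:
  assumes "p \<in> seq_polys R B" "q \<in> seq_polys R C"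
    and D: "\<And>i. additive_subgroup (D i) R"
    and BCD: "\<And>i j b c. b \<in> B i \<Longrightarrow> c \<in> C j \<Longrightarrow> b \<otimes> c \<in> D (i + j)"
  shows "p \<otimes>\<^bsub>P\<^esub> q \<in> seq_polys R D"
proof (rule seq_polysI)
  note p = seq_polysD[OF assms(1)] and q = seq_polysD[OF assms(2)]
  show "p \<otimes>\<^bsub>P\<^esub> q \<in> carrier P" using p q by simp
  fix k
  have "coeff P p i \<otimes> coeff P q (k - i) \<in> D k" if "i \<le> k" for i
    using BCD[OF p(2) q(2), of i "k - i"] that by simp
  then have "(\<Oplus>i\<in>{..k}. coeff P p i \<otimes> coeff P q (k - i)) \<in> D k"
    by (intro R.finsum_in_additive_subgroup[OF D]) auto
  then show "coeff P (p \<otimes>\<^bsub>P\<^esub> q) k \<in> D k" using p q by simp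
qed

lemma additive_subgroup_seq_polys:
  assumes D: "\<And>i. additive_subgroup (D i) R"
  shows "additive_subgroup (seq_polys R D) P"
proof (rule additive_subgroupI, rule P.add.subgroupI)
  note cl = additive_subgroup.zero_closed[OF D] additive_subgroup.a_closed[OF D]
    additive_subgroup.a_inv_closed[OF D]
  show "seq_polys R D \<subseteq> carrier P" by (auto dest: seq_polysD)
  have "\<zero>\<^bsub>P\<^esub> \<in> seq_polys R D" by (rule seq_polysI) (auto simp: cl)
  then show "seq_polys R D \<noteq> {}" by auto
  show "\<ominus>\<^bsub>P\<^esub> a \<in> seq_polys R D" if "a \<in> seq_polys R D" for a
    using seq_polysD[OF that] by (intro seq_polysI) (auto simp: cl)
  show "a \<oplus>\<^bsub>P\<^esub> b \<in> seq_polys R D" if "a \<in> seq_polys R D" "b \<in> seq_polys R D" for a b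
    using seq_polysD[OF that(1)] seq_polysD[OF that(2)]
    by (intro seq_polysI) (auto simp: cl)
qed

lemma subring_seq_polys:
  assumes B: "\<And>i. subring (B i) R" and mono: "\<And>i j. i \<le> j \<Longrightarrow> B i \<subseteq> B j"
  shows "subring (seq_polys R B) P"
proof -
  have sub: "additive_subgroup (B i) R" for i
    using subring.axioms(1)[OF B] by (rule additive_subgroupI)
  interpret S: additive_subgroup "seq_polys R B" P
    by (rule additive_subgroup_seq_polys[OF sub])
  show ?thesis
  proof (rule P.subringI)
    show "seq_polys R B \<subseteq> carrier P" by (rule S.a_subset)
    show "\<one>\<^bsub>P\<^esub> \<in> seq_polys R B"
      using subringE(2,3)[OF B] by (intro seq_polysI) auto
    show "\<ominus>\<^bsub>P\<^esub> h \<in> seq_polys R B" if "h \<in> seq_polys R B" for h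
      using S.a_inv_closed[OF that] .
    show "h1 \<otimes>\<^bsub>P\<^esub> h2 \<in> seq_polys R B" if "h1 \<in> seq_polys R B" "h2 \<in> seq_polys R B" for h1 h2
      using that
    proof (rule seq_polys_mult[OF _ _ sub])
      fix i j b c assume "b \<in> B i" "c \<in> B j"
      then have "b \<in> B (i + j)" "c \<in> B (i + j)" using mono[of i "i + j"] mono[of j "i + j"] by auto
      then show "b \<otimes> c \<in> B (i + j)" using subringE(6)[OF B] by blast
    qed
    show "h1 \<oplus>\<^bsub>P\<^esub> h2 \<in> seq_polys R B" if "h1 \<in> seq_polys R B" "h2 \<in> seq_polys R B" for h1 h2
      using that by (rule S.a_closed)
  qed
qed

lemma monom_in_seq_polys:
  assumes "\<And>i. \<zero> \<in> B i" "a \<in> carrier R" "a \<in> B k"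
  shows "monom P a k \<in> seq_polys R B"
  using assms by (intro seq_polysI) auto

end


section \<open>Two nested sequences of subrings\<close>

locale nested_subring_sequences = UP_cring A P
  for A :: "('a, 'm) ring_scheme" (structure) and P (structure) +
  fixes R T :: "nat \<Rightarrow> 'a set"
  assumes subring_R: "subring (R i) A" and subring_T: "subring (T i) A"
    and R_Suc: "R i \<subseteq> R (Suc i)" and T_Suc: "T i \<subseteq> T (Suc i)"
    and R_T: "R i \<subseteq> T i"
begin

abbreviation "J \<equiv> conductor_seq A R T"
abbreviation "RX \<equiv> seq_polys A R"
abbreviation "TX \<equiv> seq_polys A T"
abbreviation "JX \<equiv> seq_polys A J"

lemma R_mono: "i \<le> j \<Longrightarrow> R i \<subseteq> R j"
  by (rule lift_Suc_mono_le[of R, OF R_Suc])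

lemma T_mono: "i \<le> j \<Longrightarrow> T i \<subseteq> T j"
  by (rule lift_Suc_mono_le[of T, OF T_Suc])

lemma R_carrier: "a \<in> R i \<Longrightarrow> a \<in> carrier A"
  using subringE(1)[OF subring_R] by blast

lemma T_carrier: "a \<in> T i \<Longrightarrow> a \<in> carrier A"
  using subringE(1)[OF subring_T] by blast

text \<open>The case \<open>k = 0\<close> of the intersection already forces \<open>a \<in> R\<^sub>i\<close>, which implies membership in all
  later \<open>R\<^bsub>i+k\<^esub>\<close>.\<close>

lemma J_iff: "a \<in> J i \<longleftrightarrow> a \<in> R i \<and> (\<forall>k. \<forall>t\<in>T k. a \<otimes> t \<in> R (i + k))"
proof -
  have "(\<forall>k. a \<in> R (i + k)) \<longleftrightarrow> a \<in> R i"
  proof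
    assume "\<forall>k. a \<in> R (i + k)"
    then have "a \<in> R (i + 0)" by (rule spec)
    then show "a \<in> R i" by simp
  next
    assume "a \<in> R i"
    then show "\<forall>k. a \<in> R (i + k)" using R_mono[OF le_add1] by blast
  qed
  moreover have "a \<in> J i \<longleftrightarrow> (\<forall>k. a \<in> R (i + k) \<and> (\<forall>t\<in>T k. a \<otimes> t \<in> R (i + k)))"
    by (auto simp: conductor_seq_def conductor_def l_coset_def)
  ultimately show ?thesis by (simp add: all_conj_distrib)
qed

lemma J_R: "J i \<subseteq> R i"
  by (auto simp: J_iff)

text \<open>The graded absorption law. It makes the union of the \<open>J\<^sub>i\<close> an ideal, \<open>JX\<close> an ideal of \<open>TX\<close> and
  \<open>J\<^sub>0\<close> an ideal of \<open>T\<^sub>0\<close>.\<close>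

lemma J_mult:
  assumes "a \<in> J i" "t \<in> T k"
  shows "a \<otimes> t \<in> J (i + k)"
  unfolding J_iff
proof (intro conjI allI ballI)
  show "a \<otimes> t \<in> R (i + k)" using assms by (auto simp: J_iff)
  fix m s assume s: "s \<in> T m"
  have "t \<otimes> s \<in> T (k + m)"
    using assms(2) s T_mono[of k "k + m"] T_mono[of m "k + m"]
    by (intro subringE(6)[OF subring_T]) auto
  then have "a \<otimes> (t \<otimes> s) \<in> R (i + (k + m))" using assms(1) by (auto simp: J_iff)
  then show "a \<otimes> t \<otimes> s \<in> R (i + k + m)"
    using R.m_assoc[of a t s] R_carrier[of a i] assms s subsetD[OF J_R] T_carrier
    by (simp add: add.assoc)
qed

lemma J_mono: "i \<le> j \<Longrightarrow> J i \<subseteq> J j"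
proof
  fix a assume "i \<le> j" "a \<in> J i"
  then have "a \<otimes> \<one> \<in> J (i + (j - i))"
    using J_mult subringE(3)[OF subring_T] by blast
  moreover have "a \<in> carrier A" using \<open>a \<in> J i\<close> J_R R_carrier by blast
  ultimately show "a \<in> J j" using \<open>i \<le> j\<close> by simp
qed

lemma additive_subgroup_J: "additive_subgroup (J i) A"
proof (rule additive_subgroupI, rule R.add.subgroupI)
  note R = subringE[OF subring_R]
  show "J i \<subseteq> carrier A" using R(1) J_R by blast
  have "\<zero> \<in> J i" using R(2) by (simp add: J_iff T_carrier)
  then show "J i \<noteq> {}" by auto
  show "\<ominus> a \<in> J i" if "a \<in> J i" for a
    using that R(5) by (auto simp: J_iff T_carrier R_carrier R.l_minus)
  show "a \<oplus> b \<in> J i" if "a \<in> J i" "b \<in> J i" for a b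
    using that R(7) by (auto simp: J_iff T_carrier R_carrier R.l_distr)
qed

lemma subring_RX: "subring RX P"
  using subring_R R_mono by (rule subring_seq_polys)

lemma subring_TX: "subring TX P"
  using subring_T T_mono by (rule subring_seq_polys)

lemma RX_TX: "RX \<subseteq> TX"
  using R_T by (auto simp: seq_polys_def)

lemma JX_RX: "JX \<subseteq> RX"
  using J_R by (auto simp: seq_polys_def)

lemma additive_subgroup_JX: "additive_subgroup JX P"
  using additive_subgroup_J by (rule additive_subgroup_seq_polys)

lemma JX_mult: "p \<in> JX \<Longrightarrow> q \<in> TX \<Longrightarrow> p \<otimes>\<^bsub>P\<^esub> q \<in> JX"
  by (rule seq_polys_mult[where B = J and C = T]) (auto intro: additive_subgroup_J J_mult)

lemma monom_TX: "t \<in> T k \<Longrightarrow> monom P t k \<in> TX"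
  using subringE(2)[OF subring_T] T_carrier by (intro monom_in_seq_polys) auto

text \<open>The coefficient of \<open>p \<cdot> t x^k\<close> at \<open>i + k\<close> is \<open>p\<^sub>i t\<close>, so multiplying by monomials recovers all
  conditions that define \<open>J\<^sub>i\<close>.\<close>

lemma conductor_seq_polys: "conductor P RX TX = JX"
proof
  show "JX \<subseteq> conductor P RX TX"
    using JX_RX JX_mult by (auto simp: conductor_def l_coset_def)
  show "conductor P RX TX \<subseteq> JX"
  proof
    fix p assume "p \<in> conductor P RX TX"
    then have p: "p \<in> RX" and pT: "\<And>q. q \<in> TX \<Longrightarrow> p \<otimes>\<^bsub>P\<^esub> q \<in> RX"
      by (auto simp: conductor_def l_coset_def)
    have "coeff P p i \<in> J i" for i
      unfolding J_iff
    proof (intro conjI allI ballI)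
      show "coeff P p i \<in> R i" using p by (rule seq_polysD)
      fix k t assume t: "t \<in> T k"
      have tc: "t \<in> carrier A" and pc: "\<And>i. coeff P p i \<in> carrier A"
        using t T_carrier seq_polysD[OF p] R_carrier by auto
      have "coeff P (p \<otimes>\<^bsub>P\<^esub> monom P t k) (i + k) \<in> R (i + k)"
        using pT[OF monom_TX[OF t]] by (rule seq_polysD)
      also have "coeff P (p \<otimes>\<^bsub>P\<^esub> monom P t k) (i + k)
          = (\<Oplus>j\<in>{..i + k}. if i = j then coeff P p j \<otimes> t else \<zero>)"
      proof -
        have "coeff P (p \<otimes>\<^bsub>P\<^esub> monom P t k) (i + k)
            = (\<Oplus>j\<in>{..i + k}. coeff P p j \<otimes> coeff P (monom P t k) (i + k - j))"
          using tc seq_polysD(1)[OF p] by (intro coeff_mult) auto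
        also have "\<dots> = (\<Oplus>j\<in>{..i + k}. if i = j then coeff P p j \<otimes> t else \<zero>)"
          using tc pc by (intro R.finsum_cong') auto
        finally show ?thesis .
      qed
      also have "\<dots> = coeff P p i \<otimes> t"
        using tc pc by (intro R.finsum_singleton) auto
      finally show "coeff P p i \<otimes> t \<in> R (i + k)" .
    qed
    then show "p \<in> JX" using seq_polysD(1)[OF p] by (rule seq_polysI[rotated])
  qed
qed

lemma comaximal_TX: "t \<in> TX \<Longrightarrow>
    comaximal_in P TX t JX \<longleftrightarrow>
    (\<exists>b\<in>TX. \<exists>i\<in>JX. t \<otimes>\<^bsub>P\<^esub> b \<oplus>\<^bsub>P\<^esub> i = \<one>\<^bsub>P\<^esub>)"
  using JX_mult JX_RX RX_TX
  by (intro P.comaximal_in_iff[OF subring_TX additive_subgroup_JX]) auto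

lemma comaximal_RX: "r \<in> RX \<Longrightarrow>
    comaximal_in P RX r JX \<longleftrightarrow>
    (\<exists>b\<in>RX. \<exists>i\<in>JX. r \<otimes>\<^bsub>P\<^esub> b \<oplus>\<^bsub>P\<^esub> i = \<one>\<^bsub>P\<^esub>)"
  using JX_mult JX_RX RX_TX
  by (intro P.comaximal_in_iff[OF subring_RX additive_subgroup_JX]) auto

lemma J0_mult: "i \<in> J 0 \<Longrightarrow> b \<in> T 0 \<Longrightarrow> i \<otimes> b \<in> J 0"
  using J_mult[of i 0 b 0] by simp

lemma comaximal_T0: "t \<in> T 0 \<Longrightarrow>
    comaximal_in A (T 0) t (J 0) \<longleftrightarrow>
    (\<exists>b\<in>T 0. \<exists>i\<in>J 0. t \<otimes> b \<oplus> i = \<one>)"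
  using J0_mult J_R R_T
  by (intro R.comaximal_in_iff[OF subring_T additive_subgroup_J]) blast+

lemma comaximal_R0: "r \<in> R 0 \<Longrightarrow>
    comaximal_in A (R 0) r (J 0) \<longleftrightarrow>
    (\<exists>b\<in>R 0. \<exists>i\<in>J 0. r \<otimes> b \<oplus> i = \<one>)"
  using J0_mult J_R R_T
  by (intro R.comaximal_in_iff[OF subring_R additive_subgroup_J]) blast+

text \<open>The operations of \<open>TX\<close> are those of the ambient polynomial ring, and comaximality means an equation
  \<open>f g + h = 1\<close>. In this form both directions of the theorem become computations with
  coefficients.\<close>

lemma locally_associated_iff:
  "locally_associated_subring RX (P\<lparr>carrier := TX\<rparr>) \<longleftrightarrow>
    (\<forall>f\<in>TX. (\<exists>g\<in>TX. \<exists>h\<in>JX. f \<otimes>\<^bsub>P\<^esub> g \<oplus>\<^bsub>P\<^esub> h = \<one>\<^bsub>P\<^esub>) \<longrightarrow>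
      (\<exists>r\<in>RX. (\<exists>s\<in>RX. \<exists>h\<in>JX. r \<otimes>\<^bsub>P\<^esub> s \<oplus>\<^bsub>P\<^esub> h = \<one>\<^bsub>P\<^esub>) \<and>
        (\<exists>u\<in>Units (P\<lparr>carrier := TX\<rparr>). f = r \<otimes>\<^bsub>P\<^esub> u)))"
proof -
  let ?TX = "P\<lparr>carrier := TX\<rparr>"
  have "cring ?TX"
    using P.subcring_iff[OF subringE(1)[OF subring_TX]] P.subcringI'[OF subring_TX] by simp
  moreover have "subring RX ?TX"
  proof -
    interpret TX: cring ?TX by fact
    have "ring (P\<lparr>carrier := RX\<rparr>)" using subring_RX by (rule P.subring_is_ring)
    then show ?thesis using TX.subring_iff[of RX] RX_TX by simp
  qed
  moreover have "comaximal_in ?TX = comaximal_in P"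
    by (simp add: fun_eq_iff comaximal_in_def l_coset_def set_add_def set_mult_def)
  moreover have "conductor ?TX = conductor P"
    by (simp add: fun_eq_iff conductor_def l_coset_def)
  ultimately show ?thesis
    by (simp add: locally_associated_subring_def conductor_seq_polys comaximal_TX comaximal_RX
        cong: conj_cong bex_cong)
qed

lemma subring_T_Union: "subring (\<Union>i. T i) A"
proof (rule R.subringI)
  note T = subringE[OF subring_T]
  show "(\<Union>i. T i) \<subseteq> carrier A" using T(1) by blast
  show "\<one> \<in> (\<Union>i. T i)" using T(3)[of 0] by blast
  show "\<ominus> h \<in> (\<Union>i. T i)" if "h \<in> (\<Union>i. T i)" for h using that T(5) by blast
  show "a \<otimes> b \<in> (\<Union>i. T i)" "a \<oplus> b \<in> (\<Union>i. T i)"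
    if ab: "a \<in> (\<Union>i. T i)" "b \<in> (\<Union>i. T i)" for a b
  proof -
    obtain i j where "a \<in> T i" "b \<in> T j" using ab by blast
    then have "a \<in> T (max i j)" "b \<in> T (max i j)"
      using T_mono[of i "max i j"] T_mono[of j "max i j"] by auto
    then have "a \<otimes> b \<in> T (max i j)" "a \<oplus> b \<in> T (max i j)"
      by (rule T(6), rule T(7))
    then show "a \<otimes> b \<in> (\<Union>i. T i)" "a \<oplus> b \<in> (\<Union>i. T i)" by auto
  qed
qed

lemma ideal_J_Union: "ideal (\<Union>i. J i) (A\<lparr>carrier := \<Union>i. T i\<rparr>)"
proof -
  let ?T = "A\<lparr>carrier := \<Union>i. T i\<rparr>"
  interpret T: ring ?T by (rule R.subring_is_ring[OF subring_T_Union])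
  have sub: "(\<Union>i. J i) \<subseteq> (\<Union>i. T i)"
    by (rule UN_mono[OF subset_refl]) (rule subset_trans[OF J_R R_T])
  have r: "a \<otimes> x \<in> (\<Union>i. J i)" if a: "a \<in> (\<Union>i. J i)" and x: "x \<in> (\<Union>i. T i)" for a x
  proof -
    obtain i k where "a \<in> J i" "x \<in> T k" using a x by blast
    then have "a \<otimes> x \<in> J (i + k)" by (rule J_mult)
    then show ?thesis by (rule UN_I[OF UNIV_I])
  qed
  have l: "x \<otimes> a \<in> (\<Union>i. J i)" if a: "a \<in> (\<Union>i. J i)" and x: "x \<in> (\<Union>i. T i)" for a x
  proof -
    note carrier = subsetD[OF subringE(1)[OF subring_T_Union]]
    have "x \<otimes> a = a \<otimes> x"
      using carrier[OF x] carrier[OF subsetD[OF sub a]] by (rule R.m_comm)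
    then show ?thesis using r[OF a x] by simp
  qed
  note J_closed = additive_subgroup.zero_closed[OF additive_subgroup_J]
    additive_subgroup.a_closed[OF additive_subgroup_J]
  show ?thesis
  proof (rule idealI[OF T.ring_axioms])
    show "subgroup (\<Union>i. J i) (add_monoid ?T)"
    proof (rule T.add.subgroupI)
      show "(\<Union>i. J i) \<subseteq> carrier ?T" using sub by simp
      show "(\<Union>i. J i) \<noteq> {}" using J_closed(1)[of 0] by blast
    next
      fix a assume a: "a \<in> (\<Union>i. J i)"
      then have aT: "a \<in> carrier ?T" using subsetD[OF sub a] by simp
      have "\<ominus>\<^bsub>?T\<^esub> a = (\<ominus>\<^bsub>?T\<^esub> \<one>\<^bsub>?T\<^esub>) \<otimes>\<^bsub>?T\<^esub> a" 
        by (simp only: T.l_minus[OF T.one_closed aT] T.l_one[OF aT])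
      moreover have "\<ominus>\<^bsub>?T\<^esub> \<one>\<^bsub>?T\<^esub> \<in> carrier ?T" by (rule T.a_inv_closed) (rule T.one_closed)
      ultimately show "\<ominus>\<^bsub>?T\<^esub> a \<in> (\<Union>i. J i)" using l[OF a] by simp
    next
      fix a b assume "a \<in> (\<Union>i. J i)" "b \<in> (\<Union>i. J i)"
      then obtain i j where ij: "a \<in> J i" "b \<in> J j" by blast
      then have "a \<in> J (max i j)" "b \<in> J (max i j)"
        using J_mono[of i "max i j"] J_mono[of j "max i j"] by auto
      then have "a \<oplus> b \<in> J (max i j)" by (rule J_closed(2))
      then show "a \<oplus>\<^bsub>?T\<^esub> b \<in> (\<Union>i. J i)" by auto
    qed
  next
    show "x \<otimes>\<^bsub>?T\<^esub> a \<in> (\<Union>i. J i)" if "a \<in> (\<Union>i. J i)" "x \<in> carrier ?T" for a x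
      using l[OF that(1)] that(2) by simp
    show "a \<otimes>\<^bsub>?T\<^esub> x \<in> (\<Union>i. J i)" if "a \<in> (\<Union>i. J i)" "x \<in> carrier ?T" for a x
      using r[OF that(1)] that(2) by simp
  qed
qed

lemma coeff_radical_J:
  assumes f: "f \<in> TX" and g: "g \<in> TX" and h: "h \<in> JX"
    and "f \<otimes>\<^bsub>P\<^esub> g \<oplus>\<^bsub>P\<^esub> h = \<one>\<^bsub>P\<^esub>" and "i \<ge> 1"
  shows "\<exists>n::nat. n \<ge> 1 \<and> coeff P f i [^] n \<in> (\<Union>i. J i)"
proof (rule coeff_radical_of_unit_mod_ideal[OF subring_T_Union ideal_J_Union _ _ _ _ _ _ assms(4,5)])
  fix i
  show "coeff P f i \<in> (\<Union>i. T i)" using seq_polysD(2)[OF f, of i] by (rule UN_I[OF UNIV_I])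
  show "coeff P g i \<in> (\<Union>i. T i)" using seq_polysD(2)[OF g, of i] by (rule UN_I[OF UNIV_I])
  show "coeff P h i \<in> (\<Union>i. J i)" using seq_polysD(2)[OF h, of i] by (rule UN_I[OF UNIV_I])
qed (fact seq_polysD(1)[OF f] seq_polysD(1)[OF g] seq_polysD(1)[OF h])+

lemma coeff_unit_nilpotent:
  assumes f: "f \<in> TX" and g: "g \<in> TX" and fg: "f \<otimes>\<^bsub>P\<^esub> g = \<one>\<^bsub>P\<^esub>" and "i \<ge> 1"
  shows "coeff P f i \<in> nilpotents A (T i)"
proof -
  interpret T: ring "A\<lparr>carrier := \<Union>i. T i\<rparr>" by (rule R.subring_is_ring[OF subring_T_Union])
  have ideal_zero: "ideal {\<zero>} (A\<lparr>carrier := \<Union>i. T i\<rparr>)" using T.zeroideal by simp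
  have fg0: "f \<otimes>\<^bsub>P\<^esub> g \<oplus>\<^bsub>P\<^esub> \<zero>\<^bsub>P\<^esub> = \<one>\<^bsub>P\<^esub>" using fg by simp
  have "\<exists>n::nat. n \<ge> 1 \<and> coeff P f i [^] n \<in> {\<zero>}"
  proof (rule coeff_radical_of_unit_mod_ideal[OF subring_T_Union ideal_zero _ _ _ _ _ _ fg0 \<open>i \<ge> 1\<close>])
    fix i
    show "coeff P f i \<in> (\<Union>i. T i)" using seq_polysD(2)[OF f, of i] by (rule UN_I[OF UNIV_I])
    show "coeff P g i \<in> (\<Union>i. T i)" using seq_polysD(2)[OF g, of i] by (rule UN_I[OF UNIV_I])
  qed (use seq_polysD(1)[OF f] seq_polysD(1)[OF g] in auto)
  then show ?thesis using seq_polysD(2)[OF f, of i] by (simp add: nilpotents_def)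
qed

text \<open>If the constant polynomial \<open>t\<close> factors as \<open>r u\<close>, then the unit wanted is the inverse of the
  constant coefficient of \<open>u\<close>, because it carries \<open>t\<close> to the constant coefficient of \<open>r\<close>.\<close>

lemma comaximal_unit_multiple_if_locally_associated:
  assumes la: "locally_associated_subring RX (P\<lparr>carrier := TX\<rparr>)"
    and t: "t \<in> T 0" and "comaximal_in A (T 0) t (J 0)"
  shows "\<exists>u\<in>Units (A\<lparr>carrier := T 0\<rparr>). t \<otimes> u \<in> R 0 \<and> comaximal_in A (R 0) (t \<otimes> u) (J 0)"
proof -
  obtain b j where b: "b \<in> T 0" and j: "j \<in> J 0" and tbj: "t \<otimes> b \<oplus> j = \<one>"
    using assms(3) comaximal_T0[OF t] by blast
  have carr: "t \<in> carrier A" "b \<in> carrier A" "j \<in> carrier A"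
    using t b j T_carrier J_R R_carrier by blast+
  have "monom P j 0 \<in> JX"
    using additive_subgroup.zero_closed[OF additive_subgroup_J] j carr
    by (intro monom_in_seq_polys) auto
  moreover have "monom P t 0 \<otimes>\<^bsub>P\<^esub> monom P b 0 \<oplus>\<^bsub>P\<^esub> monom P j 0 = \<one>\<^bsub>P\<^esub>"
  proof -
    have "monom P t 0 \<otimes>\<^bsub>P\<^esub> monom P b 0 \<oplus>\<^bsub>P\<^esub> monom P j 0 = monom P (t \<otimes> b \<oplus> j) 0"
      using monom_mult[OF carr(1,2), of 0 0] carr by simp
    then show ?thesis using tbj by simp
  qed
  ultimately obtain r s h u where r: "r \<in> RX" and s: "s \<in> RX" and h: "h \<in> JX"
    and rsh: "r \<otimes>\<^bsub>P\<^esub> s \<oplus>\<^bsub>P\<^esub> h = \<one>\<^bsub>P\<^esub>"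
    and u: "u \<in> Units (P\<lparr>carrier := TX\<rparr>)" and tru: "monom P t 0 = r \<otimes>\<^bsub>P\<^esub> u"
    using la[unfolded locally_associated_iff] monom_TX[OF t] monom_TX[OF b] by meson
  obtain v where uv: "u \<in> TX" "v \<in> TX" "u \<otimes>\<^bsub>P\<^esub> v = \<one>\<^bsub>P\<^esub>" "v \<otimes>\<^bsub>P\<^esub> u = \<one>\<^bsub>P\<^esub>"
    using u by (auto simp: Units_def)
  note P = seq_polysD(1)[OF r] seq_polysD(1)[OF s] seq_polysD(1)[OF h]
    seq_polysD(1)[OF uv(1)] seq_polysD(1)[OF uv(2)]
  let ?r = "coeff P r 0" and ?s = "coeff P s 0" and ?h = "coeff P h 0"
    and ?u = "coeff P u 0" and ?v = "coeff P v 0"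
  have c0: "?r \<in> R 0" "?s \<in> R 0" "?h \<in> J 0" "?u \<in> T 0" "?v \<in> T 0"
    using seq_polysD(2) r s h uv by blast+
  have "?u \<otimes> ?v = \<one>" "?v \<otimes> ?u = \<one>"
    using coeff_mult_0[OF P(4,5)] coeff_mult_0[OF P(5,4)] uv by simp_all
  then have unit: "?v \<in> Units (A\<lparr>carrier := T 0\<rparr>)"
    using c0 by (auto simp: Units_def)
  have "coeff P (monom P t 0) 0 = ?r \<otimes> ?u"
    using coeff_mult_0[OF P(1,4)] tru by simp
  then have "t \<otimes> ?v = ?r"
    using carr P \<open>?u \<otimes> ?v = \<one>\<close> by (simp add: R.m_assoc)
  moreover have "coeff P (r \<otimes>\<^bsub>P\<^esub> s \<oplus>\<^bsub>P\<^esub> h) 0 = \<one>" using rsh by simp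
  then have "?r \<otimes> ?s \<oplus> ?h = \<one>" using P by simp
  ultimately show ?thesis
    using unit c0 comaximal_R0[OF c0(1)] by (intro bexI[of _ ?v]) auto
qed

text \<open>The polynomial \<open>1 - t x^k\<close> is comaximal to the conductor, and the unit part of its factorisation
  already lies in \<open>RX\<close>.\<close>

lemma radical_subset_if_locally_associated:
  assumes la: "locally_associated_subring RX (P\<lparr>carrier := TX\<rparr>)"
    and nil: "\<And>i. i \<ge> 1 \<Longrightarrow> nilpotents A (T i) \<subseteq> R i"
    and k: "k \<ge> 1" and t: "t \<in> T k" and tn: "t [^] (n::nat) \<in> (\<Union>i. J i)"
  shows "t \<in> R k"
proof -
  note T = subringE[OF subring_T]
  have tc: "t \<in> carrier A" using t T_carrier by blast
  obtain m where m: "t [^] n \<in> J m" using tn by blast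
  \<comment> \<open>Multiplying \<open>t^n \<in> J\<^sub>m\<close> by a further power of \<open>t\<close>, which is in \<open>T\<^sub>k\<close>, costs only \<open>k\<close>
    in the index, however large that power is; the exponent of \<open>x\<close> meanwhile grows.\<close>
  define N where "N = n + (m + k)"
  have "t [^] l \<in> T k" for l :: nat
    by (induction l) (use T t in auto)
  then have "t [^] n \<otimes> t [^] (m + k) \<in> J (m + k)" using J_mult[OF m] by blast
  then have "t [^] N \<in> J (m + k)" using tc by (simp add: N_def R.nat_pow_mult)
  moreover have "m + k \<le> k * N"
  proof -
    have "m + k \<le> N" by (simp add: N_def)
    also have "N \<le> k * N" using k by simp
    finally show ?thesis .
  qed
  ultimately have tN: "t [^] N \<in> J (k * N)" using J_mono by blast

  let ?z = "monom P t k"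
  have zTX: "?z \<in> TX" by (rule monom_TX[OF t])
  have zP: "?z \<in> carrier P" using tc by simp
  have "?z [^]\<^bsub>P\<^esub> N \<in> JX"
    using tN tc additive_subgroup.zero_closed[OF additive_subgroup_J]
    by (simp add: monom_pow monom_in_seq_polys)
  moreover obtain s where "s \<in> TX" "(\<one>\<^bsub>P\<^esub> \<ominus>\<^bsub>P\<^esub> ?z) \<otimes>\<^bsub>P\<^esub> s \<oplus>\<^bsub>P\<^esub> ?z [^]\<^bsub>P\<^esub> N = \<one>\<^bsub>P\<^esub>"
    using P.geometric_sum_in_subring[OF subring_TX zTX] by blast
  moreover have "\<one>\<^bsub>P\<^esub> \<ominus>\<^bsub>P\<^esub> ?z \<in> TX"
    using subringE(3,5,7)[OF subring_TX] zTX by (simp add: P.minus_eq)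
  ultimately obtain r s h u where r: "r \<in> RX" and s: "s \<in> RX" and h: "h \<in> JX"
    and rsh: "r \<otimes>\<^bsub>P\<^esub> s \<oplus>\<^bsub>P\<^esub> h = \<one>\<^bsub>P\<^esub>"
    and u: "u \<in> Units (P\<lparr>carrier := TX\<rparr>)" and zru: "\<one>\<^bsub>P\<^esub> \<ominus>\<^bsub>P\<^esub> ?z = r \<otimes>\<^bsub>P\<^esub> u"
    using la[unfolded locally_associated_iff] by meson
  obtain v where uv: "u \<in> TX" "v \<in> TX" "u \<otimes>\<^bsub>P\<^esub> v = \<one>\<^bsub>P\<^esub>"
    using u by (auto simp: Units_def)
  note P = seq_polysD(1)[OF r] seq_polysD(1)[OF s] seq_polysD(1)[OF h] seq_polysD(1)[OF uv(1)]
  let ?r = "coeff P r 0" and ?s = "coeff P s 0" and ?h = "coeff P h 0" and ?u = "coeff P u 0"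
  have c0: "?r \<in> R 0" "?s \<in> R 0" "?h \<in> J 0" "?u \<in> T 0"
    using seq_polysD(2) r s h uv by blast+
  have cc: "?r \<in> carrier A" "?s \<in> carrier A" "?h \<in> carrier A" "?u \<in> carrier A"
    using P by auto
  have coeff_z: "coeff P (\<one>\<^bsub>P\<^esub> \<ominus>\<^bsub>P\<^esub> ?z) i = coeff P \<one>\<^bsub>P\<^esub> i \<ominus> coeff P ?z i" for i
    using zP by (simp add: P.minus_eq R.minus_eq del: coeff_one coeff_monom)
  have "?r \<otimes> ?u = coeff P (\<one>\<^bsub>P\<^esub> \<ominus>\<^bsub>P\<^esub> ?z) 0"
    using coeff_mult_0[OF P(1,4)] zru by simp
  then have ru: "?r \<otimes> ?u = \<one>"
    using k tc by (simp add: coeff_z R.minus_eq)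
  have "coeff P (r \<otimes>\<^bsub>P\<^esub> s \<oplus>\<^bsub>P\<^esub> h) 0 = \<one>" using rsh by simp
  then have rs: "?r \<otimes> ?s \<oplus> ?h = \<one>" using P by simp
  \<comment> \<open>The inverse of \<open>r\<^sub>0\<close> is \<open>s\<^sub>0\<close> up to an element of \<open>J\<^sub>0\<close>, hence in \<open>R\<^sub>0\<close>.\<close>
  have "(?r \<otimes> ?s \<oplus> ?h) \<otimes> ?u = (?r \<otimes> ?u) \<otimes> ?s \<oplus> ?h \<otimes> ?u"
    using cc by algebra
  then have "?u = ?s \<oplus> ?h \<otimes> ?u" unfolding ru rs using cc by simp
  moreover have "?h \<otimes> ?u \<in> R 0" using J0_mult[OF c0(3,4)] J_R by blast
  ultimately have u0: "?u \<in> R 0" using subringE(7)[OF subring_R c0(2)] by metis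
  have "coeff P u i \<in> R i" for i
  proof (cases "i = 0")
    case False
    then show ?thesis using coeff_unit_nilpotent[OF uv, of i] nil[of i] by auto
  qed (use u0 in simp)
  then have "u \<in> RX" by (rule seq_polysI[OF P(4)])
  then have "\<one>\<^bsub>P\<^esub> \<ominus>\<^bsub>P\<^esub> ?z \<in> RX" unfolding zru by (rule subringE(6)[OF subring_RX r])
  then have "coeff P (\<one>\<^bsub>P\<^esub> \<ominus>\<^bsub>P\<^esub> ?z) k \<in> R k" by (rule seq_polysD)
  then have "\<ominus> t \<in> R k" using k tc by (simp add: coeff_z R.minus_eq)
  then have "\<ominus> (\<ominus> t) \<in> R k" by (rule subringE(5)[OF subring_R])
  then show ?thesis using tc by simp
qed

text \<open>Both \<open>f\<close> and its inverse \<open>g\<close> modulo the conductor have to be moved into \<open>RX\<close>. They are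
  multiplied by mutually inverse constants, which leaves the product \<open>f g\<close> unchanged.\<close>

lemma locally_associated_if:
  assumes const: "\<And>t. t \<in> T 0 \<Longrightarrow> comaximal_in A (T 0) t (J 0) \<Longrightarrow>
      \<exists>u\<in>Units (A\<lparr>carrier := T 0\<rparr>). t \<otimes> u \<in> R 0 \<and> comaximal_in A (R 0) (t \<otimes> u) (J 0)"
    and rad: "\<And>k t n. k \<ge> 1 \<Longrightarrow> t \<in> T k \<Longrightarrow> n \<ge> 1 \<Longrightarrow> t [^] (n::nat) \<in> (\<Union>i. J i) \<Longrightarrow> t \<in> R k"
  shows "locally_associated_subring RX (P\<lparr>carrier := TX\<rparr>)"
  unfolding locally_associated_iff
proof (intro ballI impI)
  fix f assume f: "f \<in> TX" and "\<exists>g\<in>TX. \<exists>h\<in>JX. f \<otimes>\<^bsub>P\<^esub> g \<oplus>\<^bsub>P\<^esub> h = \<one>\<^bsub>P\<^esub>"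
  then obtain g h where g: "g \<in> TX" and h: "h \<in> JX" and fgh: "f \<otimes>\<^bsub>P\<^esub> g \<oplus>\<^bsub>P\<^esub> h = \<one>\<^bsub>P\<^esub>"
    by blast
  note P = seq_polysD(1)[OF f] seq_polysD(1)[OF g] seq_polysD(1)[OF h]
  have f0: "coeff P f 0 \<in> T 0" using f by (rule seq_polysD)
  have "coeff P (f \<otimes>\<^bsub>P\<^esub> g \<oplus>\<^bsub>P\<^esub> h) 0 = \<one>" using fgh by simp
  then have "coeff P f 0 \<otimes> coeff P g 0 \<oplus> coeff P h 0 = \<one>" using P by simp
  then have "comaximal_in A (T 0) (coeff P f 0) (J 0)"
    using comaximal_T0[OF f0] seq_polysD(2)[OF g] seq_polysD(2)[OF h] by blast
  then obtain u where u: "u \<in> Units (A\<lparr>carrier := T 0\<rparr>)" and fu: "coeff P f 0 \<otimes> u \<in> R 0"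
    and "comaximal_in A (R 0) (coeff P f 0 \<otimes> u) (J 0)"
    using const[OF f0] by blast
  then obtain b j where b: "b \<in> R 0" and j: "j \<in> J 0" and fubj: "coeff P f 0 \<otimes> u \<otimes> b \<oplus> j = \<one>"
    using comaximal_R0[OF fu] by blast
  obtain w where uw: "u \<in> T 0" "w \<in> T 0" "u \<otimes> w = \<one>" "w \<otimes> u = \<one>"
    using u by (auto simp: Units_def)
  have uwc: "u \<in> carrier A" "w \<in> carrier A" using uw T_carrier by auto
  let ?u = "monom P u 0" and ?w = "monom P w 0"
  have uwP: "?u \<otimes>\<^bsub>P\<^esub> ?w = \<one>\<^bsub>P\<^esub>" "?w \<otimes>\<^bsub>P\<^esub> ?u = \<one>\<^bsub>P\<^esub>"
    using monom_mult[of u w 0 0] monom_mult[of w u 0 0] uw uwc by simp_all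
  have uP: "?u \<in> carrier P" and wP: "?w \<in> carrier P" using uwc by simp_all
  define F where "F = f \<otimes>\<^bsub>P\<^esub> ?u"
  define G where "G = ?w \<otimes>\<^bsub>P\<^esub> g"
  have FTX: "F \<in> TX" and GTX: "G \<in> TX"
    unfolding F_def G_def
    using subringE(6)[OF subring_TX] f g monom_TX[OF uw(1)] monom_TX[OF uw(2)] by blast+
  have FGP: "F \<in> carrier P" "G \<in> carrier P" using FTX GTX seq_polysD(1) by blast+
  have "F \<otimes>\<^bsub>P\<^esub> G = f \<otimes>\<^bsub>P\<^esub> (?u \<otimes>\<^bsub>P\<^esub> ?w) \<otimes>\<^bsub>P\<^esub> g"
    unfolding F_def G_def using P uP wP by (simp add: P.m_assoc)
  then have FGh: "F \<otimes>\<^bsub>P\<^esub> G \<oplus>\<^bsub>P\<^esub> h = \<one>\<^bsub>P\<^esub>" using uwP P fgh by simp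
  then have GFh: "G \<otimes>\<^bsub>P\<^esub> F \<oplus>\<^bsub>P\<^esub> h = \<one>\<^bsub>P\<^esub>" using P.m_comm[OF FGP] by simp

  have F0: "coeff P F 0 = coeff P f 0 \<otimes> u"
    unfolding F_def using coeff_mult_0[OF P(1) uP] uwc by simp
  \<comment> \<open>An inverse of \<open>F\<^sub>0\<close> modulo \<open>J\<^sub>0\<close> exists in \<open>R\<^sub>0\<close>, and inverses are unique modulo \<open>J\<^sub>0\<close>.\<close>
  have G0: "coeff P G 0 \<in> R 0"
  proof -
    let ?F = "coeff P F 0" and ?G = "coeff P G 0" and ?h = "coeff P h 0"
    have carr: "?F \<in> carrier A" "?G \<in> carrier A" "?h \<in> carrier A" "b \<in> carrier A" "j \<in> carrier A"
      using FGP P b j J_R R_carrier by auto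
    have "coeff P (F \<otimes>\<^bsub>P\<^esub> G \<oplus>\<^bsub>P\<^esub> h) 0 = \<one>" using FGh by simp
    then have e1: "?F \<otimes> ?G \<oplus> ?h = \<one>" using FGP P by simp
    have e2: "?F \<otimes> b \<oplus> j = \<one>" using fubj F0 by simp
    have "(?F \<otimes> b \<oplus> j) \<otimes> ?G \<oplus> b \<otimes> ?h = b \<otimes> (?F \<otimes> ?G \<oplus> ?h) \<oplus> j \<otimes> ?G"
      using carr by algebra
    then have "?G \<oplus> b \<otimes> ?h = b \<oplus> j \<otimes> ?G" unfolding e1 e2 using carr by simp
    moreover have "b \<oplus> j \<otimes> ?G \<in> R 0"
      using b J0_mult[OF j seq_polysD(2)[OF GTX]] J_R by (intro subringE(7)[OF subring_R]) auto
    moreover have "b \<otimes> ?h \<in> R 0"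
      using b seq_polysD(2)[OF h] J_R by (intro subringE(6)[OF subring_R]) auto
    ultimately show ?thesis
      using R.additive_subgroup_cancel_right[OF additive_subgroupI[OF subring.axioms(1)[OF subring_R]]]
        carr(2) by metis
  qed
  have high: "coeff P F i \<in> R i" "coeff P G i \<in> R i" if i: "i \<ge> 1" for i
    using coeff_radical_J[OF FTX GTX h FGh i] coeff_radical_J[OF GTX FTX h GFh i]
      rad[OF i seq_polysD(2)[OF FTX]] rad[OF i seq_polysD(2)[OF GTX]] by auto
  have "coeff P F i \<in> R i" "coeff P G i \<in> R i" for i
    using high[of i] F0 G0 fu by (cases "i = 0"; simp)+
  then have "F \<in> RX" "G \<in> RX" using FGP by (auto intro: seq_polysI)
  moreover have "?w \<in> Units (P\<lparr>carrier := TX\<rparr>)"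
    using monom_TX[OF uw(1)] monom_TX[OF uw(2)] uwP by (auto simp: Units_def)
  moreover have "f = F \<otimes>\<^bsub>P\<^esub> ?w"
    unfolding F_def using P uP wP uwP by (simp add: P.m_assoc)
  ultimately show "\<exists>r\<in>RX. (\<exists>s\<in>RX. \<exists>h\<in>JX. r \<otimes>\<^bsub>P\<^esub> s \<oplus>\<^bsub>P\<^esub> h = \<one>\<^bsub>P\<^esub>) \<and>
      (\<exists>u\<in>Units (P\<lparr>carrier := TX\<rparr>). f = r \<otimes>\<^bsub>P\<^esub> u)"
    using FGh h by blast
qed

end

section \<open>Locally associated polynomial subrings\<close>

theorem theorem4p6:
  fixes A :: "('a, 'm) ring_scheme" (structure)
    and R T J :: "nat \<Rightarrow> 'a set" and J_union :: "'a set"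
  assumes "cring A"
    and "\<And>i. subring (R i) A" and "\<And>i. subring (T i) A"
    and "\<And>i. R i \<subseteq> R (Suc i)" and "\<And>i. T i \<subseteq> T (Suc i)"
    and "\<And>i. R i \<subseteq> T i"
    and "J = conductor_seq A R T" and "J_union = (\<Union>i. J i)"
    and "\<And>i. i \<ge> 1 \<Longrightarrow> nilpotents A (T i) \<subseteq> R i"
  shows "locally_associated_subring (seq_polys A R) ((UP A)\<lparr>carrier := seq_polys A T\<rparr>) \<longleftrightarrow>
    (\<forall>t \<in> T 0. comaximal_in A (T 0) t (J 0) \<longrightarrow>
       (\<exists>u \<in> Units (A\<lparr>carrier := T 0\<rparr>). t \<otimes> u \<in> R 0 \<and> comaximal_in A (R 0) (t \<otimes> u) (J 0))) \<and>
    (\<forall>k \<ge> 1. {t \<in> T k. \<exists>n::nat. n \<ge> 1 \<and> t [^] n \<in> J_union} \<subseteq> R k)"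
proof -
  interpret nested_subring_sequences A "UP A" R T
    by (intro nested_subring_sequences.intro UP_cring.intro
        nested_subring_sequences_axioms.intro) (use assms(1-6) in auto)
  note J = assms(7) and U = assms(8) and nil = assms(9)
  show ?thesis
    unfolding J U
  proof (intro iffI conjI ballI impI allI)
    assume la: "locally_associated_subring RX ((UP A)\<lparr>carrier := TX\<rparr>)"
    show "\<exists>u\<in>Units (A\<lparr>carrier := T 0\<rparr>). t \<otimes> u \<in> R 0 \<and>
        comaximal_in A (R 0) (t \<otimes> u) (conductor_seq A R T 0)"
      if "t \<in> T 0" "comaximal_in A (T 0) t (conductor_seq A R T 0)" for t
      using la that by (rule comaximal_unit_multiple_if_locally_associated)
    show "{t \<in> T k. \<exists>n::nat. n \<ge> 1 \<and> t [^] n \<in> (\<Union>i. conductor_seq A R T i)} \<subseteq> R k"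
      if "k \<ge> 1" for k
    proof
      fix t assume "t \<in> {t \<in> T k. \<exists>n::nat. n \<ge> 1 \<and> t [^] n \<in> (\<Union>i. conductor_seq A R T i)}"
      then obtain n :: nat where t: "t \<in> T k" "t [^] n \<in> (\<Union>i. conductor_seq A R T i)"
        by (elim CollectE conjE exE)
      show "t \<in> R k"
        using la nil \<open>k \<ge> 1\<close> t by (rule radical_subset_if_locally_associated)
    qed
  next
    assume *: "(\<forall>t \<in> T 0. comaximal_in A (T 0) t (conductor_seq A R T 0) \<longrightarrow>
        (\<exists>u \<in> Units (A\<lparr>carrier := T 0\<rparr>). t \<otimes> u \<in> R 0 \<and>
          comaximal_in A (R 0) (t \<otimes> u) (conductor_seq A R T 0))) \<and>
      (\<forall>k \<ge> 1. {t \<in> T k. \<exists>n::nat. n \<ge> 1 \<and> t [^] n \<in> (\<Union>i. conductor_seq A R T i)} \<subseteq> R k)"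
    note const = conjunct1[OF *] and rad = conjunct2[OF *]
    show "locally_associated_subring RX ((UP A)\<lparr>carrier := TX\<rparr>)"
    proof (rule locally_associated_if)
      show "\<exists>u\<in>Units (A\<lparr>carrier := T 0\<rparr>). t \<otimes> u \<in> R 0 \<and>
          comaximal_in A (R 0) (t \<otimes> u) (conductor_seq A R T 0)"
        if "t \<in> T 0" "comaximal_in A (T 0) t (conductor_seq A R T 0)" for t
        by (rule mp[OF bspec[OF const that(1)] that(2)])
      show "t \<in> R k"
        if "k \<ge> 1" "t \<in> T k" "n \<ge> 1" "t [^] n \<in> (\<Union>i. conductor_seq A R T i)" for k t and n :: nat
      proof (rule subsetD[OF mp[OF spec[OF rad] that(1)]], rule CollectI, intro conjI exI)
      qed (fact that)+
    qed
  qed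
qed

end
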